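(* Let $K$ be a field of characteristic $\ell \geq 0$, and let $\phi \in K(z)$ be bicritical of degree $d \geq 2$ with critical points $\gamma_1, \gamma_2 \in \mathbb{P}^1(\overline{K})$. Assume that $\ell = 0$ or $\ell > d$. If $K(\gamma_1, \gamma_2) \neq K$, then one of the following holds: (1) $\phi$ has no critical orbit relations; (2) $\gamma_1$ and $\gamma_2$ are both pre-periodic with the same period and pre-period; (3) neither $\gamma_1$ nor $\gamma_2$ is pre-periodic and there is some $n \geq 2$ with $\phi^n(\gamma_1) = \phi^n(\gamma_2)$.
   Context: $\overline{K}$ is a fixed algebraic closure of $K$. Write $\phi = p/q$ with $p,q\in K[z]$ having no common root in $\overline K$. For $\alpha\in\overline K$ the ramification index $e_\alpha(\phi)$ is the order of vanishing at $z=\alpha$ of $p(z)q(\alpha)-q(z)p(\alpha)$; and $e_\infty(\phi)=e_0(\psi)$ where $\psi(z)=1/\phi(1/z)$. A point $\alpha\in\mathbb{P}^1(\overline K)$ is a critical point of $\phi$ if $e_\alpha(\phi)>1$. The map $\phi$ is bicritical if it has precisely two (distinct) critical points $\gamma_1,\gamma_2$ in $\mathbb{P}^1(\overline K)$. By convention $K(\infty)=K$, and $\phi^0$ is the identity. A critical orbit relation for $\phi$ is any equality $\phi^n(\gamma_i)=\phi^m(\gamma_j)$ with $i,j\in\{1,2\}$ (not necessarily distinct), $n,m\ge0$, and $(i,n)\ne(j,m)$. A point $\alpha$ is pre-periodic under $\phi$ if there are $s>t\ge0$ with $\phi^s(\alpha)=\phi^t(\alpha)$; when $s$ and $t$ are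 both minimal, $t$ is the pre-period of $\alpha$ and $s-t$ is the period of $\alpha$. *)

theory Defs
  imports "HOL-Algebra.Algebraic_Closure_Type" "HOL-Algebra.Generated_Fields"
begin

text \<open>The field \<open>K\<close> is the type \<open>'k\<close>, its algebraic closure is \<^typ>\<open>'k alg_closure\<close> with embedding
  \<^const>\<open>to_ac\<close>, and \<open>K(z)\<close> is \<^typ>\<open>'k poly fract\<close>.\<close>

datatype 'a proj_line = Affine 'a | Infinity

abbreviation ac_poly :: "'k :: field poly \<Rightarrow> 'k alg_closure poly" where
  "ac_poly \<equiv> map_poly to_ac"


definition lowest_terms :: "'k :: field poly fract \<Rightarrow> 'k poly \<times> 'k poly \<Rightarrow> bool" where
  "lowest_terms \<phi> = (\<lambda>(p, q). q \<noteq> 0 \<and> \<phi> = Fract p q \<and>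
     \<not> (\<exists>\<alpha>. poly (ac_poly p) \<alpha> = 0 \<and> poly (ac_poly q) \<alpha> = 0))"

lemma poly_ac_add: "poly (ac_poly (a + b)) \<alpha> = poly (ac_poly a) \<alpha> + poly (ac_poly b) \<alpha>"
proof -
  have "ac_poly (a + b) = ac_poly a + ac_poly b"
    by (intro poly_eqI) (simp add: coeff_map_poly)
  thus ?thesis by simp
qed

lemma poly_ac_mult: "poly (ac_poly (a * b)) \<alpha> = poly (ac_poly a) \<alpha> * poly (ac_poly b) \<alpha>"
proof -
  have "ac_poly (a * b) = ac_poly a * ac_poly b"
    by (intro poly_eqI) (simp add: coeff_map_poly coeff_mult to_ac_sum)
  thus ?thesis by simp
qed

lemma lowest_terms_exists: "\<exists>pq. lowest_terms \<phi> pq"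
proof -
  define P where "P = (\<lambda>n. \<exists>p q. q \<noteq> 0 \<and> \<phi> = Fract p q \<and> Polynomial.degree q = n)"
  have "\<exists>n. P n"
    unfolding P_def by (cases \<phi>) auto
  then have "P (LEAST n. P n)"
    by (metis LeastI)
  then obtain p q where q: "q \<noteq> 0" "\<phi> = Fract p q" "Polynomial.degree q = (LEAST n. P n)"
    unfolding P_def by blast
  have "\<not> (poly (ac_poly p) \<alpha> = 0 \<and> poly (ac_poly q) \<alpha> = 0)" for \<alpha>
  proof
    assume *: "poly (ac_poly p) \<alpha> = 0 \<and> poly (ac_poly q) \<alpha> = 0"
    define Q where "Q = (\<lambda>g. g \<noteq> 0 \<and> poly (ac_poly g) \<alpha> = 0)"
    have "Q q" using * q by (simp add: Q_def)
    then obtain g where g: "Q g" and min: "\<And>h. Q h \<Longrightarrow> Polynomial.degree g \<le> Polynomial.degree h"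
      using ex_has_least_nat[of Q q Polynomial.degree] by blast
    have dvd: "g dvd f" if f: "poly (ac_poly f) \<alpha> = 0" for f
    proof (rule ccontr)
      assume ndvd: "\<not> g dvd f"
      then have nz: "f mod g \<noteq> 0" by (simp add: dvd_eq_mod_eq_0)
      have "poly (ac_poly f) \<alpha> =
              poly (ac_poly (f div g)) \<alpha> * poly (ac_poly g) \<alpha> + poly (ac_poly (f mod g)) \<alpha>"
        by (metis div_mult_mod_eq poly_ac_add poly_ac_mult)
      then have "poly (ac_poly (f mod g)) \<alpha> = 0" using f g by (simp add: Q_def)
      then have "Polynomial.degree g \<le> Polynomial.degree (f mod g)"
        using nz min by (simp add: Q_def)
      moreover have "f mod g = 0 \<or> Polynomial.degree (f mod g) < Polynomial.degree g"
        using degree_mod_less[of g f] g by (simp add: Q_def)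
      ultimately show False using nz by simp
    qed
    obtain p' q' where pq': "p = g * p'" "q = g * q'"
      using dvd[of p] dvd[of q] * by (auto elim!: dvdE)
    have "Polynomial.degree g > 0"
    proof (rule ccontr)
      assume "\<not> Polynomial.degree g > 0"
      then obtain c where "g = [:c:]" using degree_eq_zeroE by blast
      with g show False by (simp add: Q_def map_poly_pCons)
    qed
    moreover have "q' \<noteq> 0" "g \<noteq> 0" using q pq' by auto
    ultimately have "Polynomial.degree q' < Polynomial.degree q"
      using pq' by (simp add: degree_mult_eq)
    moreover have "\<phi> = Fract p' q'"
      using q pq' \<open>q' \<noteq> 0\<close> \<open>g \<noteq> 0\<close> by (simp add: eq_fract algebra_simps)
    then have "P (Polynomial.degree q')" using \<open>q' \<noteq> 0\<close> by (auto simp: P_def)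
    then have "(LEAST n. P n) \<le> Polynomial.degree q'" by (rule Least_le)
    ultimately show False using q(3) by simp
  qed
  then have "lowest_terms \<phi> (p, q)" using q by (auto simp: lowest_terms_def)
  then show ?thesis ..
qed

text \<open>The representation in lowest terms is unique up to a common scalar factor in \<open>K\<close>; none of
  the notions below depends on the choice of this factor.\<close>

definition rat_num :: "'k :: field poly fract \<Rightarrow> 'k poly" where
  "rat_num \<phi> = fst (SOME pq. lowest_terms \<phi> pq)"

definition rat_den :: "'k :: field poly fract \<Rightarrow> 'k poly" where
  "rat_den \<phi> = snd (SOME pq. lowest_terms \<phi> pq)"

lemma lowest_terms_num_den: "lowest_terms \<phi> (rat_num \<phi>, rat_den \<phi>)"
  using someI_ex[OF lowest_terms_exists[of \<phi>]] by (simp add: rat_num_def rat_den_def)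

definition rat_degree :: "'k :: field poly fract \<Rightarrow> nat" where
  "rat_degree \<phi> = max (Polynomial.degree (rat_num \<phi>)) (Polynomial.degree (rat_den \<phi>))"

text \<open>The map induced on the projective line. At infinity one compares the coefficients
  of \<open>z ^ d\<close>, where \<open>d\<close> is the degree of \<open>\<phi>\<close>; these do not both vanish.\<close>

primrec rat_map ::
    "'k :: field poly fract \<Rightarrow> 'k alg_closure proj_line \<Rightarrow> 'k alg_closure proj_line" where
  "rat_map \<phi> (Affine \<alpha>) =
     (if poly (ac_poly (rat_den \<phi>)) \<alpha> = 0 then Infinity
      else Affine (poly (ac_poly (rat_num \<phi>)) \<alpha> / poly (ac_poly (rat_den \<phi>)) \<alpha>))"
| "rat_map \<phi> Infinity =
     (if Polynomial.coeff (rat_den \<phi>) (rat_degree \<phi>) = 0 then Infinity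
      else Affine (to_ac (Polynomial.coeff (rat_num \<phi>) (rat_degree \<phi>) /
                          Polynomial.coeff (rat_den \<phi>) (rat_degree \<phi>))))"


text \<open>The composition \<open>\<phi>(g(z))\<close>, meaningful whenever the denominator of \<open>\<phi>\<close> does not vanish
  at \<open>g\<close>; in particular for every non-constant \<open>g\<close>.\<close>

definition rat_subst :: "'k :: field poly fract \<Rightarrow> 'k poly fract \<Rightarrow> 'k poly fract" where
  "rat_subst \<phi> g = poly (map_poly (\<lambda>c. to_fract [:c:]) (rat_num \<phi>)) g /
                   poly (map_poly (\<lambda>c. to_fract [:c:]) (rat_den \<phi>)) g"

definition rat_at_infinity :: "'k :: field poly fract \<Rightarrow> 'k poly fract" where
  "rat_at_infinity \<phi> = 1 / rat_subst \<phi> (1 / to_fract [:0, 1:])"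

text \<open>For constant \<open>\<phi>\<close> the polynomial below is zero and the value is meaningless.\<close>

definition affine_ram_index :: "'k :: field poly fract \<Rightarrow> 'k alg_closure \<Rightarrow> nat" where
  "affine_ram_index \<phi> \<alpha> =
     (let p = ac_poly (rat_num \<phi>); q = ac_poly (rat_den \<phi>)
      in Polynomial.order \<alpha> (smult (poly q \<alpha>) p - smult (poly p \<alpha>) q))"

primrec ram_index :: "'k :: field poly fract \<Rightarrow> 'k alg_closure proj_line \<Rightarrow> nat" where
  "ram_index \<phi> (Affine \<alpha>) = affine_ram_index \<phi> \<alpha>"
| "ram_index \<phi> Infinity = affine_ram_index (rat_at_infinity \<phi>) 0"

definition critical_points :: "'k :: field poly fract \<Rightarrow> 'k alg_closure proj_line set" where
  "critical_points \<phi> = {P. ram_index \<phi> P > 1}"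

definition bicritical :: "'k :: field poly fract \<Rightarrow> bool" where
  "bicritical \<phi> \<longleftrightarrow> card (critical_points \<phi>) = 2"

text \<open>The field generated over \<open>K\<close> by a set of points, with the convention \<open>K(\<infinity>) = K\<close>.\<close>

definition field_adjoin :: "'k :: field alg_closure proj_line set \<Rightarrow> 'k alg_closure set" where
  "field_adjoin S = generate_field ring_of_type_algebra (range to_ac \<union> {\<alpha>. Affine \<alpha> \<in> S})"


text \<open>Here \<open>\<gamma> 1\<close> and \<open>\<gamma> 2\<close> are the two critical points; other values of \<open>\<gamma>\<close> are irrelevant.\<close>

definition critical_orbit_relation ::
    "'k :: field poly fract \<Rightarrow> (nat \<Rightarrow> 'k alg_closure proj_line) \<Rightarrow>
       nat \<Rightarrow> nat \<Rightarrow> nat \<Rightarrow> nat \<Rightarrow> bool" where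
  "critical_orbit_relation \<phi> \<gamma> i n j m \<longleftrightarrow>
     i \<in> {1, 2} \<and> j \<in> {1, 2} \<and> (i, n) \<noteq> (j, m) \<and>
     (rat_map \<phi> ^^ n) (\<gamma> i) = (rat_map \<phi> ^^ m) (\<gamma> j)"

definition preperiodic :: "'k :: field poly fract \<Rightarrow> 'k alg_closure proj_line \<Rightarrow> bool" where
  "preperiodic \<phi> P \<longleftrightarrow> (\<exists>s t. s > t \<and> (rat_map \<phi> ^^ s) P = (rat_map \<phi> ^^ t) P)"

text \<open>The next two are only meaningful for preperiodic points.\<close>

definition preperiod :: "'k :: field poly fract \<Rightarrow> 'k alg_closure proj_line \<Rightarrow> nat" where
  "preperiod \<phi> P = (LEAST t. \<exists>s>t. (rat_map \<phi> ^^ s) P = (rat_map \<phi> ^^ t) P)"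

definition period :: "'k :: field poly fract \<Rightarrow> 'k alg_closure proj_line \<Rightarrow> nat" where
  "period \<phi> P = (LEAST s. \<exists>t<s. (rat_map \<phi> ^^ s) P = (rat_map \<phi> ^^ t) P) - preperiod \<phi> P"

end

theory Submission
  imports Defs
begin

text \<open>
  The point is that \<open>\<gamma> 1\<close> and \<open>\<gamma> 2\<close> are exchanged by a Galois conjugation over \<open>K\<close>; the
  conclusion is a consequence of this symmetry alone.

  The affine critical points are the roots of the Wronskian \<open>W = p' q - p q'\<close>, a polynomial over
  \<open>K\<close>. Let \<open>\<alpha>\<close> be a critical point outside \<open>K\<close> and \<open>m\<close> its minimal polynomial. Since \<open>m\<close> divides
  \<open>W\<close>, every root of \<open>m\<close> is critical, so \<open>m\<close> has at most two roots. Tameness makes \<open>m\<close> separable: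
  where \<open>\<phi>\<close> has ramification index \<open>e \<le> d\<close>, the Wronskian vanishes to order exactly \<open>e - 1\<close>, so
  \<open>\<alpha>\<close> is a root of \<open>m\<close> of multiplicity less than \<open>d\<close>; this multiplicity is invertible in \<open>K\<close>,
  hence \<open>m' \<noteq> 0\<close>. As \<open>m\<close> is not linear, it is quadratic, both critical points are affine, they are
  the two roots of \<open>m\<close>, and their sum \<open>s\<close> lies in \<open>K\<close>
  (lemma \<open>critical_points_quadratic_conjugates\<close>).

  The isomorphism \<open>K(\<alpha>) \<rightarrow> K(\<beta>)\<close> over \<open>K\<close> with \<open>\<alpha> \<mapsto> \<beta>\<close> also sends \<open>\<beta> = s - \<alpha>\<close> to \<open>s - \<beta> = \<alpha>\<close>, so it
  exchanges the critical points; and it commutes with \<open>\<phi>\<close>, whose coefficients lie in \<open>K\<close>. Every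
  equality between points of the two critical orbits therefore stays true when \<open>\<gamma> 1\<close> and \<open>\<gamma> 2\<close> are
  exchanged (lemma \<open>orbit_relation_swap\<close>). In particular the two points are preperiodic with the
  same invariants, or neither is preperiodic.
  In the latter case a relation has the form \<open>\<phi>\<^sup>n(\<gamma> 1) = \<phi>\<^sup>m(\<gamma> 2)\<close>; combined with its conjugate
  \<open>\<phi>\<^sup>n(\<gamma> 2) = \<phi>\<^sup>m(\<gamma> 1)\<close> it gives \<open>\<phi>\<^sup>2\<^sup>n(\<gamma> 1) = \<phi>\<^sup>2\<^sup>m(\<gamma> 1)\<close>, hence \<open>n = m\<close>, and the common exponent can
  be increased at will by applying \<open>\<phi>\<close> (lemma \<open>orbit_trichotomy\<close>).
\<close>

section \<open>Evaluating polynomials over the base field in the closure\<close>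

lemma ac_poly_diff: "ac_poly (f - g) = ac_poly f - ac_poly g"
  by (intro poly_eqI) (simp add: coeff_map_poly)

lemma ac_poly_mult: "ac_poly (f * g) = ac_poly f * ac_poly g"
  by (intro poly_eqI) (simp add: coeff_map_poly coeff_mult to_ac_sum)

lemma ac_poly_pderiv: "ac_poly (pderiv f) = pderiv (ac_poly f)"
  by (intro poly_eqI) (simp add: coeff_map_poly coeff_pderiv del: of_nat_Suc)

lemma degree_ac_poly: "Polynomial.degree (ac_poly f) = Polynomial.degree f"
  by (simp add: degree_map_poly)

lemma ac_poly_eq_0_iff: "ac_poly f = 0 \<longleftrightarrow> f = 0"
  by (auto simp: poly_eq_iff coeff_map_poly)

lemma degree_pos_if_root:
  fixes f :: "'a :: idom poly"
  assumes "f \<noteq> 0" and "poly f \<alpha> = 0"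
  shows "Polynomial.degree f > 0"
proof (rule ccontr)
  assume "\<not> Polynomial.degree f > 0"
  then obtain c where "f = [:c:]" using degree_eq_zeroE by blast
  with assms show False by simp
qed

section \<open>Minimal polynomials and conjugate elements\<close>

definition is_minimal_poly :: "'k :: field poly \<Rightarrow> 'k alg_closure \<Rightarrow> bool" where
  "is_minimal_poly m \<alpha> \<longleftrightarrow> m \<noteq> 0 \<and> poly (ac_poly m) \<alpha> = 0 \<and>
     (\<forall>f. f \<noteq> 0 \<longrightarrow> poly (ac_poly f) \<alpha> = 0 \<longrightarrow> Polynomial.degree m \<le> Polynomial.degree f)"

text \<open>Equivalently, \<open>\<alpha>\<close> and \<open>\<beta>\<close> have the same minimal polynomial. In this form the relation
  transports every polynomial identity over \<open>K\<close> from \<open>\<alpha>\<close> to \<open>\<beta>\<close> and back.\<close>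

definition conjugate_over :: "'k :: field alg_closure \<Rightarrow> 'k alg_closure \<Rightarrow> bool" where
  "conjugate_over \<alpha> \<beta> \<longleftrightarrow> (\<forall>f. poly (ac_poly f) \<alpha> = 0 \<longleftrightarrow> poly (ac_poly f) \<beta> = 0)"

lemma minimal_poly_exists: "\<exists>m. is_minimal_poly m \<alpha>"
proof -
  obtain f where "f \<noteq> 0" "poly (ac_poly f) \<alpha> = 0"
    by (rule alg_closure_algebraic)
  then show ?thesis
    using ex_has_least_nat[of "\<lambda>g. g \<noteq> 0 \<and> poly (ac_poly g) \<alpha> = 0" f Polynomial.degree]
    unfolding is_minimal_poly_def by blast
qed

lemma minimal_poly_dvd:
  assumes m: "is_minimal_poly m \<alpha>" and f: "poly (ac_poly f) \<alpha> = 0"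
  shows "m dvd f"
proof (rule ccontr)
  assume "\<not> m dvd f"
  then have nz: "f mod m \<noteq> 0" by (simp add: dvd_eq_mod_eq_0)
  have "poly (ac_poly f) \<alpha> =
          poly (ac_poly (f div m)) \<alpha> * poly (ac_poly m) \<alpha> + poly (ac_poly (f mod m)) \<alpha>"
    by (metis div_mult_mod_eq poly_ac_add poly_ac_mult)
  then have "Polynomial.degree m \<le> Polynomial.degree (f mod m)"
    using m f nz by (simp add: is_minimal_poly_def)
  then show False
    using degree_mod_less[of m f] m nz by (simp add: is_minimal_poly_def)
qed

text \<open>This is the irreducibility of \<open>m\<close>: the minimal polynomial \<open>g\<close> of \<open>\<beta>\<close> divides \<open>m\<close>, and the
  cofactor has too small a degree to vanish at \<open>\<alpha>\<close>. So \<open>\<alpha>\<close> is a root of \<open>g\<close>, and polynomials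
  vanishing at either point vanish at the other.\<close>

lemma roots_of_minimal_poly_conjugate:
  assumes m: "is_minimal_poly m \<alpha>" and \<beta>: "poly (ac_poly m) \<beta> = 0"
  shows "conjugate_over \<alpha> \<beta>"
proof -
  have m0: "m \<noteq> 0" and m\<alpha>: "poly (ac_poly m) \<alpha> = 0"
    using m by (auto simp: is_minimal_poly_def)
  obtain g where g: "is_minimal_poly g \<beta>"
    using minimal_poly_exists by blast
  obtain h where h: "m = g * h"
    using minimal_poly_dvd[OF g \<beta>] by (auto elim: dvdE)
  have gh0: "g \<noteq> 0" "h \<noteq> 0" using h m0 by auto
  have "Polynomial.degree g > 0"
    using degree_pos_if_root[of "ac_poly g" \<beta>] g
    by (simp add: is_minimal_poly_def ac_poly_eq_0_iff degree_ac_poly)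
  then have "Polynomial.degree h < Polynomial.degree m"
    using gh0 h by (simp add: degree_mult_eq)
  then have "poly (ac_poly h) \<alpha> \<noteq> 0"
    using m gh0 by (auto simp: is_minimal_poly_def not_le [symmetric])
  then have g\<alpha>: "poly (ac_poly g) \<alpha> = 0"
    using m\<alpha> h by (simp add: poly_ac_mult)
  have "poly (ac_poly f) \<alpha> = 0 \<longleftrightarrow> poly (ac_poly f) \<beta> = 0" for f
  proof
    assume "poly (ac_poly f) \<alpha> = 0"
    from minimal_poly_dvd[OF m this] show "poly (ac_poly f) \<beta> = 0"
      using \<beta> by (auto simp: poly_ac_mult elim!: dvdE)
  next
    assume "poly (ac_poly f) \<beta> = 0"
    from minimal_poly_dvd[OF g this] show "poly (ac_poly f) \<alpha> = 0"
      using g\<alpha> by (auto simp: poly_ac_mult elim!: dvdE)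
  qed
  then show ?thesis by (simp add: conjugate_over_def)
qed

section \<open>The Wronskian and ramification\<close>

definition wronskian :: "'a :: idom poly \<Rightarrow> 'a poly \<Rightarrow> 'a poly" where
  "wronskian p q = pderiv p * q - p * pderiv q"

lemma ac_poly_wronskian: "ac_poly (wronskian p q) = wronskian (ac_poly p) (ac_poly q)"
  by (simp only: wronskian_def ac_poly_diff ac_poly_mult ac_poly_pderiv)

lemma order_gt_1_iff_pderiv_root:
  fixes F :: "'a :: idom poly"
  assumes "F \<noteq> 0" and "poly F \<alpha> = 0"
  shows "Polynomial.order \<alpha> F > 1 \<longleftrightarrow> poly (pderiv F) \<alpha> = 0"
proof -
  obtain u where u: "F = [:- \<alpha>, 1:] * u"
    using assms(2) unfolding poly_eq_0_iff_dvd by (rule dvdE)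
  have "Polynomial.order \<alpha> F = Suc (Polynomial.order \<alpha> u)"
    using assms(1) order_mult[of "[:- \<alpha>, 1:]" u \<alpha>] order_power_n_n[of \<alpha> 1] unfolding u by simp
  moreover have "poly (pderiv F) \<alpha> = poly u \<alpha>"
    unfolding u by (simp only: pderiv_mult poly_add poly_mult) (simp add: pderiv_pCons)
  moreover have "u \<noteq> 0" using assms(1) u by auto
  ultimately show ?thesis by (simp add: order_root)
qed

text \<open>If \<open>F = (z - \<alpha>)\<^sup>e u\<close> with \<open>u(\<alpha>) \<noteq> 0\<close>, then modulo \<open>(z - \<alpha>)\<^sup>e\<close> the derivative is \<open>e (z - \<alpha>)\<^sup>e\<^sup>-\<^sup>1 u\<close>; it is
  nonzero as long as the characteristic does not divide \<open>e\<close>.\<close>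

lemma order_power_not_dvd_pderiv:
  fixes F :: "'a :: field poly"
  assumes "F \<noteq> 0" and e: "Polynomial.order \<alpha> F = Suc n" and "of_nat (Suc n) \<noteq> (0 :: 'a)"
  shows "\<not> [:- \<alpha>, 1:] ^ Suc n dvd pderiv F"
proof
  assume dvd: "[:- \<alpha>, 1:] ^ Suc n dvd pderiv F"
  obtain u where u: "F = [:- \<alpha>, 1:] ^ Suc n * u" "\<not> [:- \<alpha>, 1:] dvd u"
    using order_decomp[OF assms(1), of \<alpha>] e by auto
  have "[:- \<alpha>, 1:] ^ Suc n dvd smult (of_nat (Suc n)) (u * [:- \<alpha>, 1:] ^ n)"
    using dvd unfolding u(1) lemma_order_pderiv1
    by (metis dvd_add_right_iff dvd_triv_left)
  then have "[:- \<alpha>, 1:] ^ Suc n dvd u * [:- \<alpha>, 1:] ^ n"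
    using assms(3) dvd_smult_cancel by blast
  then have "[:- \<alpha>, 1:] dvd u"
    using dvd_times_right_cancel_iff[of "[:- \<alpha>, 1:] ^ n" "[:- \<alpha>, 1:]" u] by (simp only: power_Suc) simp
  with u(2) show False ..
qed

text \<open>In the tame case the Wronskian vanishes at \<open>\<alpha>\<close> to order \<open>e - 1\<close>, where \<open>e \<le> d\<close> is the order
  of \<open>F = q(\<alpha>) p - p(\<alpha>) q\<close>. Indeed \<open>q(\<alpha>) W = F' q - F q'\<close> and \<open>p(\<alpha>) W = F' p - F p'\<close>, so if
  \<open>(z - \<alpha>)\<^sup>e\<close> divided \<open>W\<close> it would divide \<open>F' q\<close> and \<open>F' p\<close>; one of \<open>p\<close>, \<open>q\<close> is nonzero
  at \<open>\<alpha>\<close>, so it would divide \<open>F'\<close>.\<close>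

lemma order_bound_wronskian:
  fixes p q :: "'a :: field poly"
  defines "F \<equiv> \<lambda>\<alpha>. smult (poly q \<alpha>) p - smult (poly p \<alpha>) q"
  assumes F0: "F \<alpha> \<noteq> 0" and nocommon: "poly p \<alpha> \<noteq> 0 \<or> poly q \<alpha> \<noteq> 0"
    and deg: "Polynomial.degree p \<le> d" "Polynomial.degree q \<le> d"
    and tame: "\<And>e. 0 < e \<Longrightarrow> e \<le> d \<Longrightarrow> of_nat e \<noteq> (0 :: 'a)"
  shows "\<not> [:- \<alpha>, 1:] ^ d dvd wronskian p q"
proof
  assume dvd: "[:- \<alpha>, 1:] ^ d dvd wronskian p q"
  define t where "t = [:- \<alpha>, 1:]"
  have root: "poly (F \<alpha>) \<alpha> = 0" by (simp add: F_def)
  then obtain n where n: "Polynomial.order \<alpha> (F \<alpha>) = Suc n"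
    using F0 by (metis order_root not0_implies_Suc)
  have "Polynomial.degree (F \<alpha>) \<le> d"
    unfolding F_def using deg by (intro degree_diff_le) (auto intro: order.trans[OF degree_smult_le])
  then have nd: "Suc n \<le> d" using order_degree[OF F0, of \<alpha>] n by simp
  have tF: "t ^ Suc n dvd F \<alpha>" using order_1[of \<alpha> "F \<alpha>"] n by (simp add: t_def)
  have tW: "t ^ Suc n dvd wronskian p q"
    using dvd nd le_imp_power_dvd[of "Suc n" d t] by (auto simp: t_def intro: dvd_trans)
  have ndvd: "\<not> t ^ Suc n dvd pderiv (F \<alpha>)"
    using order_power_not_dvd_pderiv[OF F0 n] tame[of "Suc n"] nd by (simp add: t_def)
  have cancel: "t ^ Suc n dvd pderiv (F \<alpha>)"
    if "poly g \<alpha> \<noteq> 0" and eq: "pderiv (F \<alpha>) * g - F \<alpha> * pderiv g = smult (poly g \<alpha>) (wronskian p q)" for g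
  proof -
    have "t ^ Suc n dvd pderiv (F \<alpha>) * g"
      using tW tF eq by (metis diff_add_cancel dvd_add dvd_mult2 dvd_smult)
    moreover have "Polynomial.order \<alpha> g = 0" and "g \<noteq> 0"
      using that(1) by (auto simp: order_root)
    ultimately show ?thesis
      using order_mult[of "pderiv (F \<alpha>)" g \<alpha>]
      by (cases "pderiv (F \<alpha>) = 0") (auto simp: t_def order_divides simp del: power_Suc)
  qed
  define A B where "A = [:poly q \<alpha>:]" and "B = [:poly p \<alpha>:]"
  have F: "F \<alpha> = A * p - B * q" by (simp add: F_def A_def B_def)
  have F': "pderiv (F \<alpha>) = A * pderiv p - B * pderiv q"
    by (simp add: F_def A_def B_def pderiv_diff pderiv_smult)
  have "pderiv (F \<alpha>) * p - F \<alpha> * pderiv p = B * wronskian p q"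
    and "pderiv (F \<alpha>) * q - F \<alpha> * pderiv q = A * wronskian p q"
    unfolding F' unfolding F wronskian_def by (simp_all only: algebra_simps)
  then have "pderiv (F \<alpha>) * p - F \<alpha> * pderiv p = smult (poly p \<alpha>) (wronskian p q)"
    and "pderiv (F \<alpha>) * q - F \<alpha> * pderiv q = smult (poly q \<alpha>) (wronskian p q)"
    by (simp_all add: A_def B_def)
  then show False using cancel ndvd nocommon by blast
qed

lemma degree_0_if_root_free:
  fixes f :: "'a :: alg_closed_field poly"
  assumes "\<And>x. poly f x \<noteq> 0"
  shows "Polynomial.degree f = 0"
  using alg_closed_imp_poly_has_root[of f] assms by blast

text \<open>The roots of this polynomial are the affine points in the fibre of \<open>p/q\<close> through \<open>\<alpha>\<close>. If it vanished, \<open>p\<close> and \<open>q\<close>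
  would be linearly dependent, and a nonconstant one would have a root in common with the other.\<close>

lemma fibre_poly_nonzero:
  fixes p q :: "'a :: alg_closed_field poly"
  assumes nocommon: "\<And>x. \<not> (poly p x = 0 \<and> poly q x = 0)"
    and deg: "Polynomial.degree p > 0 \<or> Polynomial.degree q > 0"
  shows "smult (poly q \<alpha>) p - smult (poly p \<alpha>) q \<noteq> 0"
proof
  assume "smult (poly q \<alpha>) p - smult (poly p \<alpha>) q = 0"
  then have eq: "smult (poly q \<alpha>) p = smult (poly p \<alpha>) q" by simp
  have both_constant: "Polynomial.degree f = 0 \<and> Polynomial.degree g = 0"
    if ab: "smult a f = smult b g" "a \<noteq> 0" and nc: "\<And>x. \<not> (poly f x = 0 \<and> poly g x = 0)"
    for a b and f g :: "'a poly"
  proof -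
    have "poly g x \<noteq> 0" for x
      using arg_cong[OF ab(1), of "\<lambda>h. poly h x"] ab(2) nc[of x] by auto
    then have "Polynomial.degree g = 0" by (rule degree_0_if_root_free)
    moreover have "Polynomial.degree (smult b g) \<le> Polynomial.degree g"
      by (rule degree_smult_le)
    ultimately show ?thesis
      using arg_cong[OF ab(1), of Polynomial.degree] ab(2) by simp
  qed
  show False
  proof (cases "poly q \<alpha> = 0")
    case False
    then show False using both_constant[OF eq] nocommon deg by auto
  next
    case True
    then have "poly p \<alpha> \<noteq> 0" using nocommon by blast
    have "Polynomial.degree q = 0 \<and> Polynomial.degree p = 0"
      by (rule both_constant[OF eq[symmetric] \<open>poly p \<alpha> \<noteq> 0\<close>]) (use nocommon in blast)
    then show False using deg by simp
  qed
qed

text \<open>The case \<open>\<beta> = \<alpha>\<close> is included as an impossible one: a polynomial of degree at least two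
  cannot have a simple root as its only root. This is how a critical point at infinity will be
  excluded.\<close>

lemma quadratic_if_two_simple_roots:
  fixes F :: "'a :: alg_closed_field poly"
  assumes deg: "Polynomial.degree F \<ge> 2" and \<alpha>: "poly F \<alpha> = 0"
    and roots: "\<And>x. poly F x = 0 \<Longrightarrow> x = \<alpha> \<or> x = \<beta>"
    and simple: "\<And>x. poly F x = 0 \<Longrightarrow> poly (pderiv F) x \<noteq> 0"
  shows "\<beta> \<noteq> \<alpha> \<and> (\<exists>c. F = smult c ([:- \<alpha>, 1:] * [:- \<beta>, 1:]))"
proof -
  have F0: "F \<noteq> 0" using deg by auto
  have not_double: "\<not> F = [:- x, 1:] * ([:- x, 1:] * v)" for x v
  proof
    assume F: "F = [:- x, 1:] * ([:- x, 1:] * v)"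
    have "poly (pderiv F) x = 0"
      unfolding F by (simp only: pderiv_mult poly_add poly_mult) simp
    moreover have "poly F x = 0" unfolding F poly_mult by simp
    ultimately show False using simple by blast
  qed
  obtain u where u: "F = [:- \<alpha>, 1:] * u"
    using \<alpha> unfolding poly_eq_0_iff_dvd by (rule dvdE)
  have u0: "u \<noteq> 0" using F0 u by auto
  have "Polynomial.degree F = Suc (Polynomial.degree u)"
    unfolding u using u0 by (subst degree_mult_eq) auto
  then obtain x where x: "poly u x = 0"
    using deg alg_closed_imp_poly_has_root[of u] by auto
  then obtain v where v: "u = [:- x, 1:] * v"
    unfolding poly_eq_0_iff_dvd by (rule dvdE)
  have "x \<noteq> \<alpha>" using not_double[of \<alpha> v] u v by blast
  moreover have "poly F x = 0" using x u by (simp only: poly_mult) simp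
  ultimately have \<beta>: "x = \<beta>" "\<beta> \<noteq> \<alpha>" using roots by auto
  have Fv: "F = [:- \<alpha>, 1:] * [:- \<beta>, 1:] * v"
    using u v \<beta> by (simp only: mult.assoc)
  have "poly v y \<noteq> 0" for y
  proof
    assume y: "poly v y = 0"
    then obtain w where w: "v = [:- y, 1:] * w"
      unfolding poly_eq_0_iff_dvd by (rule dvdE)
    have "poly F y = 0" using y Fv by (simp only: poly_mult) simp
    then have "y = \<alpha> \<or> y = \<beta>" by (rule roots)
    moreover have "F = [:- \<alpha>, 1:] * ([:- \<alpha>, 1:] * ([:- \<beta>, 1:] * w))" if "y = \<alpha>"
      using Fv w that by (simp only: ac_simps)
    moreover have "F = [:- \<beta>, 1:] * ([:- \<beta>, 1:] * ([:- \<alpha>, 1:] * w))" if "y = \<beta>"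
      using Fv w that by (simp only: ac_simps)
    ultimately show False using not_double by blast
  qed
  then have "Polynomial.degree v = 0" by (rule degree_0_if_root_free)
  then obtain c where "v = [:c:]" using degree_eq_zeroE by blast
  then have "F = smult c ([:- \<alpha>, 1:] * [:- \<beta>, 1:])" using Fv by simp
  with \<beta>(2) show ?thesis by blast
qed

section \<open>Critical points outside the base field\<close>

lemma of_nat_nonzero_tame:
  assumes "CHAR('k :: field) = 0 \<or> CHAR('k) > d" and "0 < e" and "e \<le> d"
  shows "of_nat e \<noteq> (0 :: 'k alg_closure)"
  using assms by (auto simp: of_nat_eq_0_iff_char_dvd dest: dvd_imp_le)

lemma field_adjoin_rational:
  assumes "\<And>\<alpha>. Affine \<alpha> \<in> S \<Longrightarrow> \<alpha> \<in> range to_ac"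
  shows "field_adjoin S = range (to_ac :: 'k :: field \<Rightarrow> 'k alg_closure)"
proof
  interpret L: field "ring_of_type_algebra :: 'k alg_closure ring" by rule
  have gens: "range to_ac \<union> {\<alpha>. Affine \<alpha> \<in> S} = range (to_ac :: 'k \<Rightarrow> _)" using assms by auto
  show "range to_ac \<subseteq> field_adjoin S"
    unfolding field_adjoin_def gens by (auto intro: generate_field.incl)
  have neg: "\<ominus>\<^bsub>ring_of_type_algebra\<^esub> x = - x" for x :: "'k alg_closure"
    by (rule L.minus_equality) (auto simp: ring_of_type_algebra_def)
  have inv: "inv\<^bsub>ring_of_type_algebra\<^esub> x = inverse x" if "x \<noteq> 0" for x :: "'k alg_closure"
    by (rule L.comm_inv_char) (use that in \<open>auto simp: ring_of_type_algebra_def\<close>)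
  show "field_adjoin S \<subseteq> range to_ac"
  proof
    fix x assume "x \<in> field_adjoin S"
    then have "x \<in> generate_field ring_of_type_algebra (range to_ac)"
      unfolding field_adjoin_def gens .
    then show "x \<in> range to_ac"
    proof induction
      case one
      show ?case by (auto simp: ring_of_type_algebra_def intro: range_eqI[of _ _ 1])
    next
      case (incl h)
      then show ?case .
    next
      case (a_inv h)
      then show ?case by (auto simp: neg to_ac_minus [symmetric] simp del: to_ac_minus)
    next
      case (m_inv h)
      then show ?case
        by (auto simp: inv ring_of_type_algebra_def[THEN arg_cong, of ring.zero]
            to_ac_inverse [symmetric] simp del: to_ac_inverse)
    next
      case (eng_add h1 h2)
      then show ?case
        by (auto simp: ring_of_type_algebra_def to_ac_add [symmetric] simp del: to_ac_add)
    next
      case (eng_mult h1 h2)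
      then show ?case
        by (auto simp: ring_of_type_algebra_def to_ac_mult [symmetric] simp del: to_ac_mult)
    qed
  qed
qed


text \<open>The derivative of \<open>q(\<alpha>) p - p(\<alpha>) q\<close> at \<open>\<alpha>\<close> is the value there of the Wronskian.\<close>

lemma affine_critical_iff_wronskian_root:
  assumes "rat_degree \<phi> \<ge> 2"
  shows "Affine \<alpha> \<in> critical_points \<phi> \<longleftrightarrow>
    poly (ac_poly (wronskian (rat_num \<phi>) (rat_den \<phi>))) \<alpha> = 0"
proof -
  define p q where "p = ac_poly (rat_num \<phi>)" and "q = ac_poly (rat_den \<phi>)"
  define F where "F = smult (poly q \<alpha>) p - smult (poly p \<alpha>) q"
  have "F \<noteq> 0"
    unfolding F_def using lowest_terms_num_den[of \<phi>] assms
    by (intro fibre_poly_nonzero)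
       (auto simp: p_def q_def lowest_terms_def rat_degree_def degree_ac_poly)
  moreover have "poly F \<alpha> = 0" by (simp add: F_def)
  moreover have "poly (pderiv F) \<alpha> = poly (wronskian p q) \<alpha>"
    by (simp add: F_def wronskian_def pderiv_diff pderiv_smult)
  ultimately have "Polynomial.order \<alpha> F > 1 \<longleftrightarrow> poly (wronskian p q) \<alpha> = 0"
    using order_gt_1_iff_pderiv_root[of F \<alpha>] by simp
  then show ?thesis
    by (simp add: critical_points_def affine_ram_index_def Let_def F_def p_def q_def ac_poly_wronskian)
qed

text \<open>The assumption on the characteristic enters here. The multiplicity of \<open>\<alpha>\<close> in \<open>m\<close> is at most
  its multiplicity in the Wronskian, hence less than \<open>d\<close> and invertible in \<open>K\<close>. Then \<open>m'\<close> is
  nonzero, and being of smaller degree than \<open>m\<close> it cannot vanish at \<open>\<alpha>\<close>.\<close>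

lemma minimal_poly_of_critical_separable:
  fixes \<phi> :: "'k :: field poly fract"
  assumes deg: "rat_degree \<phi> \<ge> 2" and tame: "CHAR('k) = 0 \<or> CHAR('k) > rat_degree \<phi>"
    and crit: "Affine \<alpha> \<in> critical_points \<phi>" and m: "is_minimal_poly m \<alpha>"
  shows "poly (ac_poly (pderiv m)) \<alpha> \<noteq> 0"
proof -
  define W where "W = wronskian (rat_num \<phi>) (rat_den \<phi>)"
  define a where "a = Polynomial.order \<alpha> (ac_poly m)"
  have m0: "m \<noteq> 0" and root: "poly (ac_poly m) \<alpha> = 0"
    using m by (auto simp: is_minimal_poly_def)
  have "poly (ac_poly W) \<alpha> = 0"
    using crit affine_critical_iff_wronskian_root[OF deg] by (simp add: W_def)
  then have "m dvd W" by (rule minimal_poly_dvd[OF m])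
  then have "[:- \<alpha>, 1:] ^ a dvd ac_poly W"
    using order_1[of \<alpha> "ac_poly m"] unfolding a_def dvd_def[of m]
    by (auto simp: ac_poly_mult intro: dvd_mult2)
  moreover have "\<not> [:- \<alpha>, 1:] ^ rat_degree \<phi> dvd ac_poly W"
    unfolding W_def ac_poly_wronskian
  proof (rule order_bound_wronskian)
    show "smult (poly (ac_poly (rat_den \<phi>)) \<alpha>) (ac_poly (rat_num \<phi>))
        - smult (poly (ac_poly (rat_num \<phi>)) \<alpha>) (ac_poly (rat_den \<phi>)) \<noteq> 0"
      using lowest_terms_num_den[of \<phi>] deg
      by (intro fibre_poly_nonzero) (auto simp: lowest_terms_def rat_degree_def degree_ac_poly)
    show "poly (ac_poly (rat_num \<phi>)) \<alpha> \<noteq> 0 \<or> poly (ac_poly (rat_den \<phi>)) \<alpha> \<noteq> 0"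
      using lowest_terms_num_den[of \<phi>] by (auto simp: lowest_terms_def)
    show "Polynomial.degree (ac_poly (rat_num \<phi>)) \<le> rat_degree \<phi>"
      and "Polynomial.degree (ac_poly (rat_den \<phi>)) \<le> rat_degree \<phi>"
      by (simp_all add: rat_degree_def degree_ac_poly)
    show "of_nat e \<noteq> (0 :: 'k alg_closure)" if "0 < e" "e \<le> rat_degree \<phi>" for e
      by (rule of_nat_nonzero_tame[OF tame that])
  qed
  ultimately have "a < rat_degree \<phi>"
    by (meson dvd_trans le_imp_power_dvd not_le)
  moreover have "a \<noteq> 0"
    using root m0 by (simp add: a_def order_root ac_poly_eq_0_iff)
  ultimately obtain n where n: "a = Suc n" "Suc n \<le> rat_degree \<phi>"
    by (cases a) auto
  have "\<not> [:- \<alpha>, 1:] ^ Suc n dvd pderiv (ac_poly m)"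
    using n m0 of_nat_nonzero_tame[OF tame, of "Suc n"]
    by (intro order_power_not_dvd_pderiv) (auto simp: a_def ac_poly_eq_0_iff simp del: of_nat_Suc)
  then have "pderiv m \<noteq> 0" by (auto simp: ac_poly_pderiv [symmetric])
  moreover have "Polynomial.degree (pderiv m) < Polynomial.degree m"
  proof -
    have "Polynomial.degree m > 0"
      using degree_pos_if_root[of "ac_poly m" \<alpha>] m0 root
      by (simp add: ac_poly_eq_0_iff degree_ac_poly)
    moreover have "Polynomial.degree (pderiv m) \<le> Polynomial.degree m - 1"
      by (rule degree_le) (auto simp: coeff_pderiv coeff_eq_0)
    ultimately show ?thesis by linarith
  qed
  ultimately show ?thesis using m by (auto simp: is_minimal_poly_def not_le [symmetric])
qed

text \<open>All roots of the minimal polynomial of \<open>\<alpha>\<close> are simple and critical, so there are at most two of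
  them; irrationality of \<open>\<alpha>\<close> makes the degree at least two. The minimal polynomial is therefore
  quadratic with the two critical points as roots, and their sum is read off its coefficients.\<close>

lemma critical_points_quadratic_conjugates:
  fixes \<phi> :: "'k :: field poly fract"
  assumes deg: "rat_degree \<phi> \<ge> 2" and tame: "CHAR('k) = 0 \<or> CHAR('k) > rat_degree \<phi>"
    and crit: "critical_points \<phi> = {Affine \<alpha>, Q}" and irrational: "\<alpha> \<notin> range to_ac"
  shows "\<exists>\<beta> s. Q = Affine \<beta> \<and> conjugate_over \<alpha> \<beta> \<and> \<alpha> + \<beta> = to_ac s"
proof -
  define W where "W = wronskian (rat_num \<phi>) (rat_den \<phi>)"
  have crit_iff: "Affine x \<in> critical_points \<phi> \<longleftrightarrow> poly (ac_poly W) x = 0" for x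
    unfolding W_def by (rule affine_critical_iff_wronskian_root[OF deg])
  have \<alpha>W: "poly (ac_poly W) \<alpha> = 0" using crit_iff crit by blast
  obtain m where m: "is_minimal_poly m \<alpha>"
    using minimal_poly_exists by blast
  have m0: "m \<noteq> 0" and root: "poly (ac_poly m) \<alpha> = 0"
    using m by (auto simp: is_minimal_poly_def)
  have "m dvd W" by (rule minimal_poly_dvd[OF m \<alpha>W])
  then have mW: "poly (ac_poly W) x = 0" if "poly (ac_poly m) x = 0" for x
    using that by (auto simp: poly_ac_mult elim!: dvdE)
  \<comment> \<open>If \<open>Q\<close> is infinite, \<open>\<alpha>\<close> is the only possible root of \<open>m\<close>; the value \<open>\<alpha>\<close> expresses this.\<close>
  define \<beta> where "\<beta> = (case Q of Affine x \<Rightarrow> x | Infinity \<Rightarrow> \<alpha>)"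
  have roots: "x = \<alpha> \<or> x = \<beta>" if "poly (ac_poly m) x = 0" for x
  proof -
    have "Affine x \<in> {Affine \<alpha>, Q}" using crit_iff[of x] mW[OF that] crit by simp
    then show ?thesis by (auto simp: \<beta>_def)
  qed
  have simple: "poly (pderiv (ac_poly m)) x \<noteq> 0" if "poly (ac_poly m) x = 0" for x
    using roots_of_minimal_poly_conjugate[OF m that]
      minimal_poly_of_critical_separable[OF deg tame _ m] crit
    by (simp add: conjugate_over_def ac_poly_pderiv [symmetric])
  have degm: "Polynomial.degree (ac_poly m) \<ge> 2"
  proof (rule ccontr)
    assume "\<not> Polynomial.degree (ac_poly m) \<ge> 2"
    moreover have "Polynomial.degree m > 0"
      using degree_pos_if_root[of "ac_poly m" \<alpha>] m0 root
      by (simp add: ac_poly_eq_0_iff degree_ac_poly)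
    ultimately have "Polynomial.degree m = 1" by (simp add: degree_ac_poly)
    then obtain a b where ab: "m = [:b, a:]" "a \<noteq> 0" by (rule degree1_coeffs)
    then have "\<alpha> * to_ac a = - to_ac b"
      using root by (simp add: map_poly_pCons eq_neg_iff_add_eq_0 algebra_simps)
    then have "\<alpha> = to_ac (- b / a)"
      unfolding to_ac_divide to_ac_minus using ab(2) by (subst nonzero_eq_divide_eq) simp_all
    with irrational show False by blast
  qed
  obtain c where \<beta>\<alpha>: "\<beta> \<noteq> \<alpha>" and fact: "ac_poly m = smult c ([:- \<alpha>, 1:] * [:- \<beta>, 1:])"
    using quadratic_if_two_simple_roots[OF degm root roots simple] by blast
  have "Q = Affine \<beta>" using \<beta>\<alpha> by (cases Q) (auto simp: \<beta>_def)
  moreover have "poly (ac_poly m) \<beta> = 0" unfolding fact poly_smult poly_mult by simp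
  then have "conjugate_over \<alpha> \<beta>" by (rule roots_of_minimal_poly_conjugate[OF m])
  moreover have "\<alpha> + \<beta> = to_ac (- Polynomial.coeff m 1 / Polynomial.coeff m 2)"
  proof -
    have c1: "to_ac (Polynomial.coeff m 1) = - c * (\<alpha> + \<beta>)"
      using arg_cong[OF fact, of "\<lambda>f. Polynomial.coeff f 1"]
      by (simp add: coeff_map_poly algebra_simps)
    have c2: "to_ac (Polynomial.coeff m 2) = c"
      using arg_cong[OF fact, of "\<lambda>f. Polynomial.coeff f 2"]
      by (simp add: coeff_map_poly numeral_2_eq_2)
    have "c \<noteq> 0" using fact m0 ac_poly_eq_0_iff[of m] by auto
    then show ?thesis unfolding to_ac_divide to_ac_minus c1 c2 by simp
  qed
  ultimately show ?thesis by blast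
qed

section \<open>Galois conjugation on the projective line\<close>

text \<open>For conjugate \<open>\<alpha>\<close> and \<open>\<beta>\<close> this is the graph of the isomorphism \<open>K(\<alpha>) \<rightarrow> K(\<beta>)\<close> over \<open>K\<close> with
  \<open>\<alpha> \<mapsto> \<beta>\<close>. Stating it as a relation on the closure avoids extending the isomorphism
  beyond \<open>K(\<alpha>)\<close>. The values are fractions so that closure
  under division is immediate.\<close>

definition conj_values ::
    "'k :: field alg_closure \<Rightarrow> 'k alg_closure \<Rightarrow> 'k alg_closure \<Rightarrow> 'k alg_closure \<Rightarrow> bool" where
  "conj_values \<alpha> \<beta> x y \<longleftrightarrow> (\<exists>f g. poly (ac_poly g) \<alpha> \<noteq> 0 \<and> poly (ac_poly g) \<beta> \<noteq> 0 \<and>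
     x = poly (ac_poly f) \<alpha> / poly (ac_poly g) \<alpha> \<and> y = poly (ac_poly f) \<beta> / poly (ac_poly g) \<beta>)"

lemma conj_values_poly_self: "conj_values \<alpha> \<beta> (poly (ac_poly f) \<alpha>) (poly (ac_poly f) \<beta>)"
  unfolding conj_values_def by (rule exI[of _ f], rule exI[of _ 1]) simp

lemma conj_values_const: "conj_values \<alpha> \<beta> (to_ac c) (to_ac c)"
  using conj_values_poly_self[of \<alpha> \<beta> "[:c:]"] by (simp add: map_poly_pCons)

lemma conj_values_generator: "conj_values \<alpha> \<beta> \<alpha> \<beta>"
  using conj_values_poly_self[of \<alpha> \<beta> "[:0, 1:]"] by (simp add: map_poly_pCons)

text \<open>As \<open>\<beta> = s - \<alpha>\<close>, the isomorphism maps \<open>\<beta>\<close> to \<open>s - \<beta> = \<alpha>\<close>.\<close>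

lemma conj_values_swap:
  assumes "\<alpha> + \<beta> = to_ac s"
  shows "conj_values \<alpha> \<beta> \<beta> \<alpha>"
  using conj_values_poly_self[of \<alpha> \<beta> "[:s, -1:]"]
  by (simp add: map_poly_pCons assms [symmetric] to_ac_minus)

lemma conj_values_add:
  assumes "conj_values \<alpha> \<beta> x y" and "conj_values \<alpha> \<beta> x' y'"
  shows "conj_values \<alpha> \<beta> (x + x') (y + y')"
proof -
  obtain f g f' g' where
    "poly (ac_poly g) \<alpha> \<noteq> 0" "poly (ac_poly g) \<beta> \<noteq> 0"
    "x = poly (ac_poly f) \<alpha> / poly (ac_poly g) \<alpha>" "y = poly (ac_poly f) \<beta> / poly (ac_poly g) \<beta>"
    "poly (ac_poly g') \<alpha> \<noteq> 0" "poly (ac_poly g') \<beta> \<noteq> 0"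
    "x' = poly (ac_poly f') \<alpha> / poly (ac_poly g') \<alpha>" "y' = poly (ac_poly f') \<beta> / poly (ac_poly g') \<beta>"
    using assms unfolding conj_values_def by blast
  then show ?thesis
    unfolding conj_values_def
    by (intro exI[of _ "f * g' + f' * g"] exI[of _ "g * g'"])
       (simp add: poly_ac_add poly_ac_mult add_frac_eq)
qed

lemma conj_values_mult:
  assumes "conj_values \<alpha> \<beta> x y" and "conj_values \<alpha> \<beta> x' y'"
  shows "conj_values \<alpha> \<beta> (x * x') (y * y')"
proof -
  obtain f g f' g' where
    "poly (ac_poly g) \<alpha> \<noteq> 0" "poly (ac_poly g) \<beta> \<noteq> 0"
    "x = poly (ac_poly f) \<alpha> / poly (ac_poly g) \<alpha>" "y = poly (ac_poly f) \<beta> / poly (ac_poly g) \<beta>"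
    "poly (ac_poly g') \<alpha> \<noteq> 0" "poly (ac_poly g') \<beta> \<noteq> 0"
    "x' = poly (ac_poly f') \<alpha> / poly (ac_poly g') \<alpha>" "y' = poly (ac_poly f') \<beta> / poly (ac_poly g') \<beta>"
    using assms unfolding conj_values_def by blast
  then show ?thesis
    unfolding conj_values_def
    by (intro exI[of _ "f * f'"] exI[of _ "g * g'"]) (simp add: poly_ac_mult)
qed

lemma conj_values_poly:
  assumes "conj_values \<alpha> \<beta> x y"
  shows "conj_values \<alpha> \<beta> (poly (ac_poly f) x) (poly (ac_poly f) y)"
proof (induction f)
  case 0
  then show ?case using conj_values_const[of \<alpha> \<beta> 0] by simp
next
  case (pCons c f)
  then show ?case
    using conj_values_add[OF conj_values_const conj_values_mult[OF assms pCons.IH]]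
    by (simp add: map_poly_pCons)
qed

lemma conj_values_eq_0_iff:
  assumes "conjugate_over \<alpha> \<beta>" and "conj_values \<alpha> \<beta> x y"
  shows "x = 0 \<longleftrightarrow> y = 0"
proof -
  obtain f g where
    "poly (ac_poly g) \<alpha> \<noteq> 0" "poly (ac_poly g) \<beta> \<noteq> 0"
    "x = poly (ac_poly f) \<alpha> / poly (ac_poly g) \<alpha>" "y = poly (ac_poly f) \<beta> / poly (ac_poly g) \<beta>"
    using assms(2) unfolding conj_values_def by blast
  moreover have "poly (ac_poly f) \<alpha> = 0 \<longleftrightarrow> poly (ac_poly f) \<beta> = 0"
    using assms(1) unfolding conjugate_over_def by blast
  ultimately show ?thesis by simp
qed

lemma conj_values_divide:
  assumes "conjugate_over \<alpha> \<beta>" and "conj_values \<alpha> \<beta> x y" and "conj_values \<alpha> \<beta> x' y'" and "x' \<noteq> 0"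
  shows "conj_values \<alpha> \<beta> (x / x') (y / y')"
proof -
  obtain f g where
    "poly (ac_poly g) \<alpha> \<noteq> 0" "poly (ac_poly g) \<beta> \<noteq> 0"
    "x' = poly (ac_poly f) \<alpha> / poly (ac_poly g) \<alpha>" "y' = poly (ac_poly f) \<beta> / poly (ac_poly g) \<beta>"
    using assms(3) unfolding conj_values_def by blast
  then have "conj_values \<alpha> \<beta> (inverse x') (inverse y')"
    using assms(4) conj_values_eq_0_iff[OF assms(1,3)] unfolding conj_values_def
    by (intro exI[of _ g] exI[of _ f]) auto
  then show ?thesis
    using conj_values_mult[OF assms(2)] by (simp add: divide_inverse)
qed

text \<open>The relation is the graph of a function, and that function is injective.\<close>

lemma conj_values_eq_iff:
  assumes "conjugate_over \<alpha> \<beta>" and "conj_values \<alpha> \<beta> x y" and "conj_values \<alpha> \<beta> x' y'"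
  shows "x = x' \<longleftrightarrow> y = y'"
proof -
  have "conj_values \<alpha> \<beta> (x + to_ac (- 1) * x') (y + to_ac (- 1) * y')"
    by (rule conj_values_add[OF assms(2) conj_values_mult[OF conj_values_const assms(3)]])
  then have "x + to_ac (- 1) * x' = 0 \<longleftrightarrow> y + to_ac (- 1) * y' = 0"
    by (rule conj_values_eq_0_iff[OF assms(1)])
  moreover have "u + to_ac (- 1) * v = u - v" for u v :: "'a alg_closure" by simp
  ultimately show ?thesis by (simp only: right_minus_eq)
qed

abbreviation conj_points ::
    "'k :: field alg_closure \<Rightarrow> 'k alg_closure \<Rightarrow> 'k alg_closure proj_line \<Rightarrow> 'k alg_closure proj_line \<Rightarrow> bool" where
  "conj_points \<alpha> \<beta> \<equiv> rel_proj_line (conj_values \<alpha> \<beta>)"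

lemma conj_points_eq_iff:
  assumes "conjugate_over \<alpha> \<beta>" and "conj_points \<alpha> \<beta> P Q" and "conj_points \<alpha> \<beta> P' Q'"
  shows "P = P' \<longleftrightarrow> Q = Q'"
  using assms(2,3) conj_values_eq_iff[OF assms(1)]
  by (cases P; cases Q; cases P'; cases Q') auto

text \<open>Conjugation commutes with a map defined over \<open>K\<close>.\<close>

lemma conj_points_rat_map:
  assumes "conjugate_over \<alpha> \<beta>" and "conj_points \<alpha> \<beta> P Q"
  shows "conj_points \<alpha> \<beta> (rat_map \<phi> P) (rat_map \<phi> Q)"
proof (cases P)
  case Infinity
  with assms(2) have "Q = Infinity" by (cases Q) auto
  with Infinity show ?thesis by (auto intro: conj_values_const simp del: to_ac_divide)
next
  case (Affine x)
  with assms(2) obtain y where Q: "Q = Affine y" and xy: "conj_values \<alpha> \<beta> x y"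
    by (cases Q) auto
  have "poly (ac_poly (rat_den \<phi>)) x = 0 \<longleftrightarrow> poly (ac_poly (rat_den \<phi>)) y = 0"
    by (rule conj_values_eq_0_iff[OF assms(1) conj_values_poly[OF xy]])
  then show ?thesis
    using Affine Q conj_values_divide[OF assms(1) conj_values_poly[OF xy] conj_values_poly[OF xy]]
    by auto
qed

lemma conj_points_orbit:
  assumes "conjugate_over \<alpha> \<beta>" and "conj_points \<alpha> \<beta> P Q"
  shows "conj_points \<alpha> \<beta> ((rat_map \<phi> ^^ n) P) ((rat_map \<phi> ^^ n) Q)"
  by (induction n) (auto intro: assms conj_points_rat_map)

text \<open>Conjugation sends \<open>\<alpha>\<close> to \<open>\<beta>\<close> and \<open>\<beta>\<close> to \<open>\<alpha>\<close>, and it preserves and reflects equality of orbit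
  points.\<close>

lemma orbit_relation_swap:
  assumes conj: "conjugate_over \<alpha> \<beta>" and sum: "\<alpha> + \<beta> = to_ac s"
  shows "(rat_map \<phi> ^^ n) (Affine \<alpha>) = (rat_map \<phi> ^^ m) (Affine \<alpha>) \<longleftrightarrow>
         (rat_map \<phi> ^^ n) (Affine \<beta>) = (rat_map \<phi> ^^ m) (Affine \<beta>)"
    and "(rat_map \<phi> ^^ n) (Affine \<alpha>) = (rat_map \<phi> ^^ m) (Affine \<beta>) \<longleftrightarrow>
         (rat_map \<phi> ^^ n) (Affine \<beta>) = (rat_map \<phi> ^^ m) (Affine \<alpha>)"
proof -
  have \<alpha>\<beta>: "conj_points \<alpha> \<beta> (Affine \<alpha>) (Affine \<beta>)" by (simp add: conj_values_generator)
  have \<beta>\<alpha>: "conj_points \<alpha> \<beta> (Affine \<beta>) (Affine \<alpha>)" by (simp add: conj_values_swap[OF sum])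
  show "(rat_map \<phi> ^^ n) (Affine \<alpha>) = (rat_map \<phi> ^^ m) (Affine \<alpha>) \<longleftrightarrow>
         (rat_map \<phi> ^^ n) (Affine \<beta>) = (rat_map \<phi> ^^ m) (Affine \<beta>)"
    by (rule conj_points_eq_iff[OF conj conj_points_orbit[OF conj \<alpha>\<beta>] conj_points_orbit[OF conj \<alpha>\<beta>]])
  show "(rat_map \<phi> ^^ n) (Affine \<alpha>) = (rat_map \<phi> ^^ m) (Affine \<beta>) \<longleftrightarrow>
         (rat_map \<phi> ^^ n) (Affine \<beta>) = (rat_map \<phi> ^^ m) (Affine \<alpha>)"
    by (rule conj_points_eq_iff[OF conj conj_points_orbit[OF conj \<alpha>\<beta>] conj_points_orbit[OF conj \<beta>\<alpha>]])
qed

section \<open>Critical orbit relations\<close>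

text \<open>Pure dynamics: the only input about \<open>P\<close> and \<open>Q\<close> is that they may be exchanged in every relation.
  Preperiod and period are determined by the relations within one orbit, so they agree for \<open>P\<close>
  and \<open>Q\<close>. A relation across the orbits, applied twice, moves \<open>P\<close> back into its own orbit.\<close>

lemma orbit_trichotomy:
  assumes sym: "\<And>n m. (rat_map \<phi> ^^ n) P = (rat_map \<phi> ^^ m) P \<longleftrightarrow>
                      (rat_map \<phi> ^^ n) Q = (rat_map \<phi> ^^ m) Q"
    and swap: "\<And>n m. (rat_map \<phi> ^^ n) P = (rat_map \<phi> ^^ m) Q \<longleftrightarrow>
                       (rat_map \<phi> ^^ n) Q = (rat_map \<phi> ^^ m) P"
    and relation: "(n \<noteq> m \<and> (rat_map \<phi> ^^ n) P = (rat_map \<phi> ^^ m) P) \<or>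
                   (rat_map \<phi> ^^ n) P = (rat_map \<phi> ^^ m) Q"
  shows "(preperiodic \<phi> P \<and> preperiodic \<phi> Q \<and>
          period \<phi> P = period \<phi> Q \<and> preperiod \<phi> P = preperiod \<phi> Q) \<or>
         (\<not> preperiodic \<phi> P \<and> \<not> preperiodic \<phi> Q \<and>
          (\<exists>n\<ge>2. (rat_map \<phi> ^^ n) P = (rat_map \<phi> ^^ n) Q))"
proof -
  have same: "preperiodic \<phi> P \<longleftrightarrow> preperiodic \<phi> Q" "preperiod \<phi> P = preperiod \<phi> Q"
    "period \<phi> P = period \<phi> Q"
    by (simp_all add: preperiodic_def preperiod_def period_def sym)
  have preperiodicI: "preperiodic \<phi> P" if "a \<noteq> b" "(rat_map \<phi> ^^ a) P = (rat_map \<phi> ^^ b) P" for a b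
    using that unfolding preperiodic_def by (metis linorder_neq_iff)
  show ?thesis
  proof (cases "preperiodic \<phi> P")
    case True
    then show ?thesis using same by simp
  next
    case False
    with relation preperiodicI have nm: "(rat_map \<phi> ^^ n) P = (rat_map \<phi> ^^ m) Q" by blast
    then have mn: "(rat_map \<phi> ^^ n) Q = (rat_map \<phi> ^^ m) P" by (simp add: swap)
    have "(rat_map \<phi> ^^ (n + n)) P = (rat_map \<phi> ^^ (n + m)) Q"
      by (simp add: funpow_add nm)
    also have "\<dots> = (rat_map \<phi> ^^ (m + n)) Q" by (simp add: add.commute)
    also have "\<dots> = (rat_map \<phi> ^^ (m + m)) P"
      by (simp add: funpow_add mn)
    finally have "n + n = m + m" using preperiodicI False by blast
    then have "n = m" by simp
    with nm have "(rat_map \<phi> ^^ (2 + n)) P = (rat_map \<phi> ^^ (2 + n)) Q"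
      by (simp add: funpow_add)
    then show ?thesis using False same by (meson le_add1)
  qed
qed

theorem corollary3p3:
  fixes \<phi> :: "'k :: field poly fract"
    and d :: nat
    and \<gamma> :: "nat \<Rightarrow> 'k alg_closure proj_line"
  assumes "rat_degree \<phi> = d" and "d \<ge> 2"
    and "bicritical \<phi>" and "critical_points \<phi> = {\<gamma> 1, \<gamma> 2}"
    and "CHAR('k) = 0 \<or> CHAR('k) > d"
    and "field_adjoin {\<gamma> 1, \<gamma> 2} \<noteq> range to_ac"
  shows "(\<not> (\<exists>i n j m. critical_orbit_relation \<phi> \<gamma> i n j m))
    \<or> (preperiodic \<phi> (\<gamma> 1) \<and> preperiodic \<phi> (\<gamma> 2) \<and>
         period \<phi> (\<gamma> 1) = period \<phi> (\<gamma> 2) \<and> preperiod \<phi> (\<gamma> 1) = preperiod \<phi> (\<gamma> 2))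
    \<or> (\<not> preperiodic \<phi> (\<gamma> 1) \<and> \<not> preperiodic \<phi> (\<gamma> 2) \<and>
         (\<exists>n\<ge>2. (rat_map \<phi> ^^ n) (\<gamma> 1) = (rat_map \<phi> ^^ n) (\<gamma> 2)))"
proof (cases "\<exists>i n j m. critical_orbit_relation \<phi> \<gamma> i n j m")
  case False
  then show ?thesis by blast
next
  case True
  then obtain i n j m where rel: "critical_orbit_relation \<phi> \<gamma> i n j m" by blast
  have deg: "rat_degree \<phi> \<ge> 2" and tame: "CHAR('k) = 0 \<or> CHAR('k) > rat_degree \<phi>"
    using assms by auto
  obtain \<alpha> where \<alpha>: "Affine \<alpha> \<in> {\<gamma> 1, \<gamma> 2}" "\<alpha> \<notin> range to_ac"
    using field_adjoin_rational[of "{\<gamma> 1, \<gamma> 2}"] assms(6) by blast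
  have swaps: "((rat_map \<phi> ^^ a) (\<gamma> 1) = (rat_map \<phi> ^^ b) (\<gamma> 1) \<longleftrightarrow>
                (rat_map \<phi> ^^ a) (\<gamma> 2) = (rat_map \<phi> ^^ b) (\<gamma> 2)) \<and>
               ((rat_map \<phi> ^^ a) (\<gamma> 1) = (rat_map \<phi> ^^ b) (\<gamma> 2) \<longleftrightarrow>
                (rat_map \<phi> ^^ a) (\<gamma> 2) = (rat_map \<phi> ^^ b) (\<gamma> 1))" for a b
  proof (cases "\<gamma> 1 = Affine \<alpha>")
    case True
    then have "critical_points \<phi> = {Affine \<alpha>, \<gamma> 2}" using assms(4) by simp
    from critical_points_quadratic_conjugates[OF deg tame this \<alpha>(2)]
    obtain \<beta> s where "\<gamma> 2 = Affine \<beta>" "conjugate_over \<alpha> \<beta>" "\<alpha> + \<beta> = to_ac s" by blast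
    with True orbit_relation_swap[OF this(2,3), of a \<phi> b] show ?thesis by simp
  next
    case False
    then have \<gamma>2: "\<gamma> 2 = Affine \<alpha>" using \<alpha>(1) by simp
    then have "critical_points \<phi> = {Affine \<alpha>, \<gamma> 1}" using assms(4) by auto
    from critical_points_quadratic_conjugates[OF deg tame this \<alpha>(2)]
    obtain \<beta> s where "\<gamma> 1 = Affine \<beta>" "conjugate_over \<alpha> \<beta>" "\<alpha> + \<beta> = to_ac s" by blast
    with \<gamma>2 orbit_relation_swap[OF this(2,3), of a \<phi> b] orbit_relation_swap[OF this(2,3), of b \<phi> a]
    show ?thesis by auto
  qed
  \<comment> \<open>Conjugating if necessary, the left-hand side lies on the orbit of \<open>\<gamma> 1\<close>.\<close>
  have "(n \<noteq> m \<and> (rat_map \<phi> ^^ n) (\<gamma> 1) = (rat_map \<phi> ^^ m) (\<gamma> 1)) \<or>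
        (rat_map \<phi> ^^ n) (\<gamma> 1) = (rat_map \<phi> ^^ m) (\<gamma> 2)"
    using rel swaps unfolding critical_orbit_relation_def by auto
  from orbit_trichotomy[OF _ _ this] swaps show ?thesis by blast
qed

end
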